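(* Let $p$ be a prime and let $s$ be a nonnegative integer such that $p\equiv 2\pmod 3$ and $s\leq (p-2)/3$. Then $$\sum_{k=s}^{(p+1)/3+s}(6k-1)\frac{(-\frac{1}{3})_{k-s}(-\frac{1}{3})_{k+s}(-\frac{1}{3})_{k}}{(k-s)!\,(k+s)!\,k!}\equiv 0\pmod{p^3}.$$
   Context: For a nonnegative integer $m$, the shifted factorial is $(x)_0=1$ and $(x)_m=x(x+1)\cdots(x+m-1)$ for $m\ge 1$. The congruence is between rational numbers that are $p$-adic integers: $A\equiv 0\pmod{p^3}$ means $A\in p^3\mathbb{Z}_p$, where $\mathbb{Z}_p$ is the ring of $p$-adic integers. *)

theory Defs
  imports "HOL-Number_Theory.Number_Theory"
begin

definition padic_val :: "nat \<Rightarrow> rat \<Rightarrow> int" where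
  "padic_val p x =
     int (multiplicity (int p) (fst (quotient_of x))) - int (multiplicity (int p) (snd (quotient_of x)))"

definition padic_norm :: "nat \<Rightarrow> rat \<Rightarrow> rat" where
  "padic_norm p x = (if x = 0 then 0 else of_nat p powi (- padic_val p x))"

text \<open>
  The ring of \<open>p\<close>-adic integers is the closed unit ball of the completion of the rationals for the
  \<open>p\<close>-adic absolute value. Only its rational elements matter here, because the congruences
  relate rational numbers and \<open>p ^ n * z\<close> is rational only if \<open>z\<close> is.
\<close>

definition rat_padic_integers :: "nat \<Rightarrow> rat set" where
  "rat_padic_integers p = {x. padic_norm p x \<le> 1}"

definition padic_cong :: "nat \<Rightarrow> nat \<Rightarrow> rat \<Rightarrow> rat \<Rightarrow> bool" where
  "padic_cong p n x y \<longleftrightarrow>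
     x \<in> rat_padic_integers p \<and> y \<in> rat_padic_integers p \<and>
     x - y \<in> (\<lambda>z. of_nat p ^ n * z) ` rat_padic_integers p"

lemma rat_padic_integers_iff:
  assumes "prime p"
  shows "x \<in> rat_padic_integers p \<longleftrightarrow> \<not> int p dvd snd (quotient_of x)"
proof (cases "x = 0")
  case True
  with assms show ?thesis
    by (auto simp: rat_padic_integers_def padic_norm_def)
next
  case False
  obtain a b where q: "quotient_of x = (a, b)" by fastforce
  have b: "b > 0" and cop: "coprime a b" and x: "x = of_int a / of_int b"
    using q by (auto simp: quotient_of_denom_pos quotient_of_coprime quotient_of_div)
  have p1: "p > 1" using assms by (rule prime_gt_1_nat)
  have pp: "prime (int p)" using assms by simp
  have a0: "a \<noteq> 0" using False x by auto
  have "padic_norm p x \<le> 1 \<longleftrightarrow> padic_val p x \<ge> 0"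
  proof -
    have "padic_norm p x = of_nat p powi (- padic_val p x)"
      using False by (simp add: padic_norm_def)
    moreover have "(of_nat p :: rat) powi (- padic_val p x) \<le> 1" if "padic_val p x \<ge> 0"
      using that p1 by (simp add: power_int_minus power_int_def field_simps)
    moreover have "(of_nat p :: rat) powi (- padic_val p x) > 1" if "padic_val p x < 0"
      using that p1 by (simp add: power_int_def one_less_power)
    ultimately show ?thesis by (metis linorder_not_le)
  qed
  also have "\<dots> \<longleftrightarrow> multiplicity (int p) b \<le> multiplicity (int p) a"
    by (simp add: padic_val_def q)
  also have "\<dots> \<longleftrightarrow> \<not> int p dvd b"
  proof
    assume le: "multiplicity (int p) b \<le> multiplicity (int p) a"
    show "\<not> int p dvd b"
    proof
      assume d: "int p dvd b"
      have "multiplicity (int p) b > 0"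
        using d b pp by (simp add: prime_multiplicity_gt_zero_iff)
      with le have "multiplicity (int p) a > 0" by simp
      hence "int p dvd a" using a0 pp by (simp add: prime_multiplicity_gt_zero_iff)
      with d cop pp show False by (meson coprime_common_divisor not_prime_unit)
    qed
  qed (simp add: not_dvd_imp_multiplicity_0)
  finally show ?thesis by (simp add: rat_padic_integers_def q)
qed

end

theory Submission
  imports Defs "HOL-Computational_Algebra.Polynomial"
begin

text \<open>
  Put \<open>a = -1/3\<close>, \<open>M = (p + 1)/3\<close> and \<open>k = s + j\<close>. The sum is a very-well-poised series in
  \<open>A = a + 2s\<close> with numerator parameters \<open>a\<close> and \<open>a + s\<close>; replace these by \<open>a + x\<close> and
  \<open>a + s - x\<close> and clear the denominators, so that it becomes a polynomial \<open>P(x)\<close> over the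
  \<open>p\<close>-integral rationals, and the sum is a \<open>p\<close>-integral multiple of \<open>P(0)\<close>.

  For \<open>x = p/3\<close> and \<open>x = -p/3\<close> one parameter is a nonpositive integer \<open>-m\<close>, and the remaining
  ones make the sum the divided difference of a polynomial of degree \<open>m - 1\<close> at the \<open>m + 1\<close> nodes
  \<open>(j + A/2)^2\<close>. Hence \<open>P(p/3) = P(-p/3) = 0\<close>. Modulo \<open>p\<close>, \<open>a\<close> is \<open>-M\<close>, and then the reflection
  \<open>j \<mapsto> M - 2s - j\<close> changes the sign of each term because \<open>M\<close> is even for odd \<open>p\<close>
  (if \<open>2s > M\<close>, every term contains the factor \<open>0\<close>); so all coefficients
  of \<open>P\<close> are divisible by \<open>p\<close>. Adding \<open>P(p/3) = 0\<close> and \<open>P(-p/3) = 0\<close> cancels the linear term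
  and leaves \<open>2 P(0)\<close> divisible by \<open>p^3\<close>.
\<close>

section \<open>Divided differences and a vanishing very-well-poised sum\<close>

text \<open>Lagrange interpolation: \<open>f\<close> equals its interpolant \<open>L\<close>, since
  both have degree below the number of nodes. Each \<open>B j\<close> is monic of degree
  \<open>card S - 1\<close>, so the sum is the coefficient of \<open>L\<close> at that degree, which
  lies above the degree of \<open>f\<close>.\<close>

lemma divided_difference_eq_0:
  fixes f :: "'a :: field poly"
  assumes "finite S" "inj_on z S" "Suc (degree f) < card S"
  shows "(\<Sum>j\<in>S. poly f (z j) / (\<Prod>i\<in>S - {j}. z j - z i)) = 0"
proof -
  define W where "W j = (\<Prod>i\<in>S - {j}. z j - z i)" for j
  define B where "B j = (\<Prod>i\<in>S - {j}. [:- z i, 1:])" for j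
  define L where "L = (\<Sum>j\<in>S. smult (poly f (z j) / W j) (B j))"
  have deg: "degree (B j) = card S - 1" if "j \<in> S" for j
    using that assms(1) by (simp add: B_def degree_prod_sum_eq)
  have lead: "coeff (B j) (card S - 1) = 1" if "j \<in> S" for j
    using deg[OF that] lead_coeff_prod[of "\<lambda>i. [:- z i, 1:]" "S - {j}"] by (simp flip: B_def)
  have "degree L \<le> card S - 1"
    unfolding L_def using deg by (intro degree_sum_le assms(1)) (simp add: degree_smult_le le_trans)
  have "poly f x = poly L x" if "x \<in> z ` S" for x
  proof -
    from that obtain k where k: "k \<in> S" "x = z k" by auto
    have W: "W k \<noteq> 0"
      using assms(1,2) k(1) by (auto simp: W_def inj_on_def)
    have "poly (B j) x = (if j = k then W k else 0)" if "j \<in> S" for j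
      using that k assms(1) by (auto simp: B_def W_def poly_prod)
    hence "poly L x = (\<Sum>j\<in>S. if j = k then poly f (z k) else 0)"
      unfolding L_def poly_sum using W by (intro sum.cong) auto
    also have "\<dots> = poly f x"
      using assms(1) k by simp
    finally show ?thesis ..
  qed
  moreover have "card (z ` S) = card S"
    using assms(2) by (rule card_image)
  ultimately have "f = L"
    using assms(3) \<open>degree L \<le> card S - 1\<close> by (intro poly_eqI_degree[of "z ` S"]) auto
  moreover have "coeff f (card S - 1) = 0"
    using assms(3) by (intro coeff_eq_0) auto
  moreover have "coeff L (card S - 1) = (\<Sum>j\<in>S. poly f (z j) / W j)"
    unfolding L_def coeff_sum using deg lead by (intro sum.cong) auto
  ultimately show ?thesis
    by (simp add: W_def)
qed

text \<open>The 2n factors lie symmetrically about y; pairing opposite ones gives differences of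
  squares. So a Pochhammer symbol of this shape is a polynomial in y^2, of degree n.\<close>

lemma pochhammer_central_eq_prod:
  fixes y :: "'a :: field_char_0"
  shows "pochhammer (y + 1 / 2 - of_nat n) (2 * n) = (\<Prod>i<n. y\<^sup>2 - (of_nat i + 1 / 2)\<^sup>2)"
proof (induction n)
  case (Suc n)
  have "pochhammer (y + 1 / 2 - of_nat (Suc n)) (2 * Suc n)
      = (y - 1 / 2 - of_nat n) * pochhammer (y + 1 / 2 - of_nat n) (Suc (2 * n))"
    by (simp add: pochhammer_rec algebra_simps)
  also have "pochhammer (y + 1 / 2 - of_nat n) (Suc (2 * n))
      = (y + 1 / 2 + of_nat n) * pochhammer (y + 1 / 2 - of_nat n) (2 * n)"
    by (simp add: pochhammer_rec')
  also have "(y - 1 / 2 - of_nat n) * ((y + 1 / 2 + of_nat n) * pochhammer (y + 1 / 2 - of_nat n) (2 * n))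
      = (y - 1 / 2 - of_nat n) * (y + 1 / 2 + of_nat n) * pochhammer (y + 1 / 2 - of_nat n) (2 * n)"
    by (simp only: mult.assoc)
  also have "(y - 1 / 2 - of_nat n) * (y + 1 / 2 + of_nat n) = y\<^sup>2 - (of_nat n + 1 / 2)\<^sup>2"
    by (simp add: power2_eq_square field_simps)
  finally show ?case
    using Suc.IH by (simp add: mult.commute)
qed simp

lemma pochhammer_neq_0_if_not_Int:
  "x \<notin> \<int> \<Longrightarrow> pochhammer x n \<noteq> (0 :: 'a :: field_char_0)"
  by (auto simp: pochhammer_eq_0_iff)

text \<open>This is the share of the divided-difference denominator that comes from the factors j -
  i of \<open>z j - z i\<close>.\<close>

lemma prod_of_nat_diff_eq:
  assumes "j \<le> m"
  shows "(\<Prod>i\<in>{..m} - {j}. of_nat j - of_nat i :: 'a :: field_char_0) = (- 1) ^ (m - j) * fact j * fact (m - j)"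
  using assms
proof (induction m rule: dec_induct)
  case base
  have "{..j} - {j} = {0..<j}" by auto
  thus ?case
    by (simp add: fact_prod_rev of_nat_diff)
next
  case (step m)
  have "{..Suc m} - {j} = insert (Suc m) ({..m} - {j})"
    using step.hyps by auto
  moreover have "of_nat j - of_nat (Suc m) = - (of_nat (Suc (m - j)) :: 'a)"
    using step.hyps by (simp add: of_nat_diff)
  ultimately show ?case
    using step by (simp add: Suc_diff_le algebra_simps)
qed

lemma pochhammer_neg_of_nat:
  assumes "j \<le> m"
  shows "pochhammer (- of_nat m) j * fact (m - j) = (- 1) ^ j * (fact m :: 'a :: field_char_0)"
proof -
  have "pochhammer (of_nat m - of_nat j + 1) j * fact (m - j) = (fact m :: 'a)"
    using pochhammer_product[of "m - j" m "1 :: 'a"] assms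
    by (simp add: pochhammer_fact of_nat_diff add_ac mult_ac)
  thus ?thesis by (simp add: pochhammer_minus mult.assoc)
qed

text \<open>Up to the constant \<open>C\<close>, the j-th term is the j-th term of the divided
  difference of \<open>f\<close>, of degree m - 1, at the m + 1 nodes \<open>z j\<close>.
  Non-integrality of \<open>A\<close> separates the nodes; with that of \<open>d\<close> it keeps
  the denominators nonzero.\<close>

lemma very_well_poised_sum_eq_0:
  fixes A d :: "'a :: field_char_0"
  assumes "A \<notin> \<int>" "d \<notin> \<int>" "m \<ge> 1" and d: "d = (1 + A) / 2"
  defines "n \<equiv> of_nat (m - 1)"
  shows "(\<Sum>j\<le>m. (A + 2 * of_nat j) * pochhammer A j * pochhammer (- of_nat m) j * pochhammer (d + n) j
           / (fact j * pochhammer (1 + A + of_nat m) j * pochhammer (d - n) j)) = 0"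
proof -
  define z where "z j = (of_nat j + A / 2)\<^sup>2" for j :: nat
  define f where "f = (\<Prod>i<m - 1. [:- (of_nat i + 1 / 2)\<^sup>2, 1 :: 'a:])"
  define W where "W j = (\<Prod>i\<in>{..m} - {j}. z j - z i)" for j
  define C where "C = (- 1) ^ m * fact m * pochhammer A (Suc m) / pochhammer (d - n) (2 * (m - 1))"
  have notint: "A + of_nat k \<notin> \<int>" "d - n + of_nat k \<notin> \<int>" "A + of_int l \<noteq> 0" "d - n \<notin> \<int>" for k l
  proof -
    show "A + of_nat k \<notin> \<int>"
      using assms(1) Ints_diff[of "A + of_nat k" "of_nat k"] by auto
    show "d - n + of_nat k \<notin> \<int>" for k
      using assms(2) Ints_diff[of "d - n + of_nat k" "of_nat k - n"] by (auto simp: n_def)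
    from this[of 0] show "d - n \<notin> \<int>" by simp
    show "A + of_int l \<noteq> 0"
      using assms(1) Ints_minus[of "of_int l :: 'a"] by (auto simp: add_eq_0_iff2)
  qed
  have zdiff: "z j - z i = (of_nat j - of_nat i) * (A + of_nat j + of_nat i)" for i j
    by (simp add: z_def power2_eq_square field_simps)
  have degf: "degree f = m - 1"
    by (simp add: f_def degree_prod_sum_eq)
  have "inj_on z {..m}"
  proof (rule inj_onI)
    fix i j assume "z i = z j"
    hence "(of_nat i - of_nat j) * (A + of_int (int i + int j)) = 0"
      using zdiff[of i j] by (simp add: add_ac)
    thus "i = j" using notint(3) by (simp del: of_int_add of_int_of_nat_eq)
  qed
  hence zero: "(\<Sum>j\<le>m. poly f (z j) / W j) = 0"
    unfolding W_def using degf \<open>m \<ge> 1\<close> by (intro divided_difference_eq_0) auto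
  have eq: "(A + 2 * of_nat j) * pochhammer A j * pochhammer (- of_nat m) j * pochhammer (d + n) j
           / (fact j * pochhammer (1 + A + of_nat m) j * pochhammer (d - n) j) = C * (poly f (z j) / W j)"
    if "j \<le> m" for j
  proof -
    \<comment> \<open>Since d = (1 + A)/2, the pairing lemma evaluates \<open>f\<close> at
      \<open>z j\<close> as a Pochhammer symbol starting at d - n + j. Both sides are then the
      symbol of length j + 2(m - 1) at d - n, cut at j and at 2(m - 1).\<close>
    have f: "poly f (z j) * pochhammer (d - n) j = pochhammer (d - n) (2 * (m - 1)) * pochhammer (d + n) j"
    proof -
      have "poly f (z j) = pochhammer (of_nat j + A / 2 + 1 / 2 - of_nat (m - 1)) (2 * (m - 1))"
        unfolding pochhammer_central_eq_prod by (simp add: f_def z_def poly_prod)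
      also have "of_nat j + A / 2 + 1 / 2 - of_nat (m - 1) = d - n + of_nat j"
        by (simp add: d n_def field_simps)
      finally have "poly f (z j) * pochhammer (d - n) j = pochhammer (d - n) (j + 2 * (m - 1))"
        unfolding pochhammer_product' by (simp add: mult_ac)
      also have "\<dots> = pochhammer (d - n) (2 * (m - 1)) * pochhammer (d - n + of_nat (2 * (m - 1))) j"
        by (metis add.commute pochhammer_product')
      also have "d - n + of_nat (2 * (m - 1)) = d + n"
        by (simp add: n_def)
      finally show ?thesis .
    qed
    \<comment> \<open>The very-well-poised factor A + 2j is exactly the factor i = j missing from
      the product of the A + j + i. With it restored, the symbol of length j + m + 1 at A can be cut
      at m + 1 instead of j.\<close>
    have W: "W j * (A + 2 * of_nat j) * pochhammer A j
        = (- 1) ^ (m - j) * fact j * fact (m - j) * (pochhammer A (Suc m) * pochhammer (1 + A + of_nat m) j)"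
    proof -
      have "W j = (- 1) ^ (m - j) * fact j * fact (m - j) * (\<Prod>i\<in>{..m} - {j}. A + of_nat j + of_nat i)"
        unfolding W_def zdiff prod.distrib prod_of_nat_diff_eq[OF that] ..
      moreover have "pochhammer (A + of_nat j) (Suc m)
          = (\<Prod>i\<in>{..m} - {j}. A + of_nat j + of_nat i) * (A + 2 * of_nat j)"
        unfolding pochhammer_Suc_prod atMost_atLeast0
        using prod.remove[of "{0..m}" j "\<lambda>i. A + of_nat j + of_nat i"] that by (simp add: mult_ac)
      moreover have "pochhammer A j * pochhammer (A + of_nat j) (Suc m)
          = pochhammer A (Suc m) * pochhammer (A + of_nat (Suc m)) j"
        by (metis add.commute pochhammer_product')
      ultimately show ?thesis
        by (simp add: add_ac) (simp only: mult_ac)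
    qed
    note neg = pochhammer_neg_of_nat[OF that, where 'a = 'a]
    have sgn: "(- 1) ^ (m - j) * (- 1) ^ j = (- 1 :: 'a) ^ m"
      using that by (simp flip: power_add)
    \<comment> \<open>With all factors opaque, what remains is rearranging products and cancelling
      nonzero terms.\<close>
    define N P G Dp F E Dm F2 Q PA where defs: "N = A + 2 * of_nat j" "P = pochhammer A j"
      "G = pochhammer (- of_nat m :: 'a) j" "Dp = pochhammer (d + n) j" "F = (fact j :: 'a)"
      "E = pochhammer (1 + A + of_nat m) j" "Dm = pochhammer (d - n) j" "F2 = (fact (m - j) :: 'a)"
      "Q = pochhammer (d - n) (2 * (m - 1))" "PA = pochhammer A (Suc m)"
    have "E \<noteq> 0" "Dm \<noteq> 0" "Q \<noteq> 0" "PA \<noteq> 0" "F \<noteq> 0" "F2 \<noteq> 0"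
      using assms(1) notint(1)[of "Suc m"] notint(4)
      by (auto simp: defs add_ac intro!: pochhammer_neq_0_if_not_Int simp del: pochhammer_Suc)
    have "N * P * G * Dp * (Q * W j) = (W j * N * P) * G * (Q * Dp)"
      by (simp only: mult_ac)
    also have "\<dots> = (- 1) ^ (m - j) * F * (PA * E) * (G * F2) * (poly f (z j) * Dm)"
      using W f unfolding defs[symmetric] by (simp only: mult_ac)
    also have "G * F2 = (- 1) ^ j * fact m"
      using neg unfolding defs[symmetric] .
    also have "(- 1) ^ (m - j) * F * (PA * E) * ((- 1) ^ j * fact m) * (poly f (z j) * Dm)
        = ((- 1) ^ (m - j) * (- 1) ^ j) * fact m * PA * poly f (z j) * (F * E * Dm)"
      by (simp only: mult_ac)
    finally have "N * P * G * Dp * (Q * W j) = (- 1) ^ m * fact m * PA * poly f (z j) * (F * E * Dm)"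
      unfolding sgn .
    moreover have "W j \<noteq> 0"
      using W \<open>E \<noteq> 0\<close> \<open>PA \<noteq> 0\<close> \<open>F \<noteq> 0\<close> \<open>F2 \<noteq> 0\<close> unfolding defs[symmetric] by auto
    ultimately show ?thesis
      using \<open>E \<noteq> 0\<close> \<open>Dm \<noteq> 0\<close> \<open>Q \<noteq> 0\<close> \<open>F \<noteq> 0\<close>
      unfolding C_def defs[symmetric] times_divide_times_eq by (subst frac_eq_eq) auto
  qed
  have "(\<Sum>j\<le>m. C * (poly f (z j) / W j)) = 0"
    unfolding sum_distrib_left[symmetric] zero by simp
  thus ?thesis
    by (subst sum.cong[OF refl eq]) auto
qed

section \<open>The summand with cleared denominators and its reflection\<close>

lemma pochhammer_reverse:
  fixes y :: "'a :: comm_ring_1"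
  shows "pochhammer y k = (- 1) ^ k * pochhammer (1 - y - of_nat k) k"
  using pochhammer_minus[of "- y" k] by (simp add: algebra_simps)

text \<open>The denominator parameters paired with a + x and a + s - x are 1 + 2s - x and 1 + s + x;
  each pair adds up to 1 + A with A = a + 2s, so the series stays well-poised for every x. The
  symbols of length M - j are what is left of those of length M after division by those of length
  j.\<close>

definition wp_term :: "'a :: field_char_0 \<Rightarrow> nat \<Rightarrow> nat \<Rightarrow> 'a \<Rightarrow> nat \<Rightarrow> 'a" where
  "wp_term a M s x j =
     (a + 2 * of_nat s + 2 * of_nat j) * pochhammer a (j + 2 * s) * (fact M / fact j)
       * (pochhammer (a + x) j * pochhammer (1 + 2 * of_nat s + of_nat j - x) (M - j)
          * (pochhammer (a + of_nat s - x) j * pochhammer (1 + of_nat s + of_nat j + x) (M - j)))"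

text \<open>For a = -M the terms with j + 2s > M vanish. On the others, reversing the two symbols of
  length M - j matches them with the symbols of length j, so \<open>g\<close> is symmetric under j
  -> N - j; evenness preserves the sign (-1)^j, and only 2j - N changes sign. As x is arbitrary,
  this will annihilate a whole polynomial.\<close>

lemma sum_wp_term_reflection_eq_0:
  fixes x :: "'a :: field_char_0"
  assumes "even M"
  shows "(\<Sum>j\<le>M. wp_term (- of_nat M) M s x j) = 0"
proof (cases "2 * s \<le> M")
  case False
  thus ?thesis
    by (intro sum.neutral) (auto simp: wp_term_def pochhammer_of_nat_eq_0_lemma)
next
  case True
  define N where "N = M - 2 * s"
  have M: "M = N + 2 * s" and "even N" and MN: "of_nat M = of_nat N + 2 * (of_nat s :: 'a)"
    using True assms by (auto simp: N_def)
  define C where "C = fact M * fact M * pochhammer (x - 2 * of_nat s - of_nat M) (2 * s)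
    * pochhammer (1 + of_nat s + of_nat N + x) (2 * s)"
  define g where "g j = pochhammer (- of_nat M + x) j * pochhammer (- of_nat M + x) (N - j)
    * pochhammer (- of_nat M + of_nat s - x) j * pochhammer (- of_nat M + of_nat s - x) (N - j)
    / (fact j * fact (N - j))" for j
  have t: "wp_term (- of_nat M) M s x j = C * ((2 * of_nat j - of_nat N) * (- 1) ^ j * g j)" if "j \<le> N" for j
  proof -
    have sgn: "(- 1 :: 'a) ^ (M - j) = (- 1) ^ j" "(- 1 :: 'a) ^ (N - j) = (- 1) ^ j"
      "(- 1 :: 'a) ^ (j + 2 * s) = (- 1) ^ j"
      using that \<open>even M\<close> \<open>even N\<close> M by (auto simp: minus_one_power_iff)
    \<comment> \<open>The 2s surplus factors are split off at the front after reversal in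
      \<open>3\<close>, and at the end before reversal in \<open>4\<close>. In both cases they do
      not depend on j and go into \<open>C\<close>.\<close>
    have Mj: "M - j = 2 * s + (N - j)" "M - j = (N - j) + 2 * s"
      using that M by auto
    have 1: "- of_nat M + 2 * of_nat s + 2 * of_nat j = 2 * of_nat j - (of_nat N :: 'a)"
      by (simp add: MN)
    have 2: "pochhammer (- of_nat M) (j + 2 * s) = (- 1) ^ j * (fact M / fact (N - j) :: 'a)"
      using pochhammer_neg_of_nat[of "j + 2 * s" M, where 'a = 'a] that M sgn(3) by (simp add: field_simps)
    have 3: "pochhammer (1 + 2 * of_nat s + of_nat j - x) (M - j)
        = (- 1) ^ j * (pochhammer (x - 2 * of_nat s - of_nat M) (2 * s) * pochhammer (- of_nat M + x) (N - j))"
      (is "?l = _")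
    proof -
      have "?l = (- 1) ^ j * pochhammer (x - 2 * of_nat s - of_nat M) (M - j)"
      proof -
        have "1 - (1 + 2 * of_nat s + of_nat j - x) - of_nat (M - j) = x - 2 * of_nat s - of_nat M"
          using that M by (simp add: of_nat_diff)
        thus ?thesis
          by (simp only: pochhammer_reverse[of "1 + 2 * of_nat s + of_nat j - x" "M - j"] sgn)
      qed
      thus ?thesis
        unfolding Mj(1) pochhammer_product' by (simp add: algebra_simps)
    qed
    have 4: "pochhammer (1 + of_nat s + of_nat j + x) (M - j)
        = (- 1) ^ j * (pochhammer (- of_nat M + of_nat s - x) (N - j) * pochhammer (1 + of_nat s + of_nat N + x) (2 * s))"
      (is "?l = _")
    proof -
      have "?l = pochhammer (1 + of_nat s + of_nat j + x) (N - j) * pochhammer (1 + of_nat s + of_nat N + x) (2 * s)"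
        unfolding Mj(2) pochhammer_product' using that by (simp add: of_nat_diff algebra_simps)
      also have "pochhammer (1 + of_nat s + of_nat j + x) (N - j)
          = (- 1) ^ j * pochhammer (- of_nat M + of_nat s - x) (N - j)"
        using that by (subst pochhammer_reverse) (simp add: sgn MN of_nat_diff algebra_simps)
      finally show ?thesis by simp
    qed
    have "(- 1 :: 'a) ^ j * (- 1) ^ j = 1"
      by (simp flip: power_add)
    thus ?thesis
      unfolding wp_term_def 1 2 3 4 C_def g_def by (simp add: mult_ac)
  qed
  have antisym: "(2 * of_nat (N - j) - of_nat N) * (- 1) ^ (N - j) * g (N - j)
      = - ((2 * of_nat j - of_nat N) * (- 1) ^ j * g j)" if "j \<le> N" for j
  proof -
    have "g (N - j) = g j"
      using that by (simp add: g_def mult_ac)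
    moreover have "(- 1 :: 'a) ^ (N - j) = (- 1) ^ j"
      using that \<open>even N\<close> by (simp add: minus_one_power_iff)
    moreover have "2 * of_nat (N - j) - of_nat N = - (2 * of_nat j - of_nat N :: 'a)"
      using that by (simp add: of_nat_diff)
    ultimately show ?thesis by (simp only: mult_minus_left)
  qed
  have "(\<Sum>j\<le>M. wp_term (- of_nat M) M s x j) = (\<Sum>j\<le>N. wp_term (- of_nat M) M s x j)"
  proof (intro sum.mono_neutral_right ballI)
    fix j assume "j \<in> {..M} - {..N}"
    hence "M < j + 2 * s" using M by auto
    thus "wp_term (- of_nat M) M s x j = 0"
      by (simp add: wp_term_def pochhammer_of_nat_eq_0_lemma)
  qed (use M in auto)
  also have "\<dots> = C * (\<Sum>j\<le>N. (2 * of_nat j - of_nat N) * (- 1) ^ j * g j)"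
    unfolding sum_distrib_left by (intro sum.cong) (simp_all add: t)
  also have "(\<Sum>j\<le>N. (2 * of_nat j - of_nat N) * (- 1) ^ j * g j) = 0" (is "?S = 0")
  proof -
    have "?S = (\<Sum>j\<le>N. (2 * of_nat (N - j) - of_nat N) * (- 1) ^ (N - j) * g (N - j))"
      by (rule sum.atLeastAtMost_rev[of _ 0 N, simplified, folded atMost_atLeast0])
    also have "\<dots> = - ?S"
      unfolding sum_negf[symmetric] by (intro sum.cong refl antisym) simp
    finally show ?thesis by simp
  qed
  finally show ?thesis by simp
qed

section \<open>Arithmetic of p-integral rationals and polynomials\<close>

text \<open>The reduced denominator divides every other denominator, so fractions need not be in
  lowest terms. The closure proofs below can then use common denominators directly.\<close>

lemma rat_padic_integers_iff_ex:
  assumes "prime p"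
  shows "x \<in> rat_padic_integers p \<longleftrightarrow> (\<exists>a b. \<not> int p dvd b \<and> x = of_int a / of_int b)"
proof
  obtain a b where q: "quotient_of x = (a, b)" by fastforce
  assume "x \<in> rat_padic_integers p"
  thus "\<exists>a b. \<not> int p dvd b \<and> x = of_int a / of_int b"
    using q quotient_of_div[OF q] by (intro exI[of _ a] exI[of _ b]) (simp add: rat_padic_integers_iff[OF assms])
next
  obtain c d where q: "quotient_of x = (c, d)" by fastforce
  have d: "d > 0" "coprime d c" "x = of_int c / of_int d"
    using q by (auto simp: quotient_of_denom_pos quotient_of_coprime quotient_of_div coprime_commute)
  assume "\<exists>a b. \<not> int p dvd b \<and> x = of_int a / of_int b"
  then obtain a b where b: "\<not> int p dvd b" "x = of_int a / of_int b" by blast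
  have "b \<noteq> 0" using b by auto
  with b d have "of_int (c * b) = (of_int (a * d) :: rat)"
    by (simp add: field_simps)
  hence "c * b = a * d" by (simp only: of_int_eq_iff)
  hence "d dvd b"
    using d(2) by (metis coprime_dvd_mult_right_iff dvd_triv_right)
  with b(1) show "x \<in> rat_padic_integers p"
    using q by (auto simp: rat_padic_integers_iff[OF assms] dest: dvd_trans)
qed

definition padic_ideal :: "nat \<Rightarrow> nat \<Rightarrow> rat set" where
  "padic_ideal p n = (\<lambda>z. of_nat p ^ n * z) ` rat_padic_integers p"

definition poly_ideal :: "nat \<Rightarrow> nat \<Rightarrow> rat poly set" where
  "poly_ideal p n = {q. \<forall>i. coeff q i \<in> padic_ideal p n}"

text \<open>Integrality of both sides is built in because congruences between non-integral
  polynomials could not be multiplied.\<close>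

definition poly_cong :: "nat \<Rightarrow> rat poly \<Rightarrow> rat poly \<Rightarrow> bool" where
  "poly_cong p q r \<longleftrightarrow> q \<in> poly_ideal p 0 \<and> r \<in> poly_ideal p 0 \<and> q - r \<in> poly_ideal p 1"

context
  fixes p :: nat
  assumes p: "prime p"
begin

lemma padic_int_of_int: "of_int a \<in> rat_padic_integers p"
  using p prime_gt_1_nat[OF p] unfolding rat_padic_integers_iff_ex[OF p]
  by (intro exI[of _ a] exI[of _ 1]) auto

lemma padic_int_of_nat: "of_nat a \<in> rat_padic_integers p"
  using padic_int_of_int[of "int a"] by simp

lemma padic_int_inverse_of_nat:
  "\<not> p dvd b \<Longrightarrow> 1 / of_nat b \<in> rat_padic_integers p"
  unfolding rat_padic_integers_iff_ex[OF p] by (intro exI[of _ 1] exI[of _ "int b"]) auto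

lemma padic_int_add:
  assumes "x \<in> rat_padic_integers p" "y \<in> rat_padic_integers p"
  shows "x + y \<in> rat_padic_integers p"
proof -
  from assms obtain a b c d where x: "\<not> int p dvd b" "x = of_int a / of_int b"
    and y: "\<not> int p dvd d" "y = of_int c / of_int d"
    unfolding rat_padic_integers_iff_ex[OF p] by blast
  have "b \<noteq> 0" "d \<noteq> 0" using x y by auto
  hence "x + y = of_int (a * d + c * b) / of_int (b * d)"
    using x y by (simp add: field_simps)
  moreover have "\<not> int p dvd b * d"
    using x y p by (simp add: prime_dvd_mult_iff)
  ultimately show ?thesis unfolding rat_padic_integers_iff_ex[OF p] by blast
qed

lemma padic_int_mult:
  assumes "x \<in> rat_padic_integers p" "y \<in> rat_padic_integers p"
  shows "x * y \<in> rat_padic_integers p"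
proof -
  from assms obtain a b c d where x: "\<not> int p dvd b" "x = of_int a / of_int b"
    and y: "\<not> int p dvd d" "y = of_int c / of_int d"
    unfolding rat_padic_integers_iff_ex[OF p] by blast
  hence "x * y = of_int (a * c) / of_int (b * d)" by simp
  moreover have "\<not> int p dvd b * d"
    using x y p by (simp add: prime_dvd_mult_iff)
  ultimately show ?thesis unfolding rat_padic_integers_iff_ex[OF p] by blast
qed

lemma padic_int_pochhammer:
  "x \<in> rat_padic_integers p \<Longrightarrow> pochhammer x n \<in> rat_padic_integers p"
  using padic_int_of_nat[of 1]
  by (induction n) (simp_all add: pochhammer_Suc padic_int_mult padic_int_add padic_int_of_nat)

lemma padic_ideal_0_iff: "x \<in> padic_ideal p 0 \<longleftrightarrow> x \<in> rat_padic_integers p"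
  by (simp add: padic_ideal_def)

lemma padic_ideal_zero: "0 \<in> padic_ideal p n"
  using padic_int_of_int[of 0] by (force simp: padic_ideal_def)

lemma padic_ideal_add: "x \<in> padic_ideal p n \<Longrightarrow> y \<in> padic_ideal p n \<Longrightarrow> x + y \<in> padic_ideal p n"
  unfolding padic_ideal_def using padic_int_add by (force simp flip: distrib_left)

lemma padic_ideal_mult: "x \<in> padic_ideal p m \<Longrightarrow> y \<in> padic_ideal p n \<Longrightarrow> x * y \<in> padic_ideal p (m + n)"
  unfolding padic_ideal_def using padic_int_mult by (fastforce simp: power_add mult_ac)

lemma padic_ideal_sum: "(\<And>i. i \<in> S \<Longrightarrow> f i \<in> padic_ideal p n) \<Longrightarrow> sum f S \<in> padic_ideal p n"
  by (induction S rule: infinite_finite_induct) (auto simp: padic_ideal_zero padic_ideal_add)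

lemma poly_ideal_pCons_iff: "pCons c q \<in> poly_ideal p n \<longleftrightarrow> c \<in> padic_ideal p n \<and> q \<in> poly_ideal p n"
  unfolding poly_ideal_def by (auto simp: coeff_pCons split: nat.splits)

lemma poly_ideal_zero: "0 \<in> poly_ideal p n"
  by (simp add: poly_ideal_def padic_ideal_zero)

lemma poly_ideal_add: "q \<in> poly_ideal p n \<Longrightarrow> r \<in> poly_ideal p n \<Longrightarrow> q + r \<in> poly_ideal p n"
  by (simp add: poly_ideal_def padic_ideal_add)

lemma poly_ideal_mult: "q \<in> poly_ideal p m \<Longrightarrow> r \<in> poly_ideal p n \<Longrightarrow> q * r \<in> poly_ideal p (m + n)"
  unfolding poly_ideal_def by (auto simp: coeff_mult intro!: padic_ideal_sum padic_ideal_mult)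

lemma poly_cong_refl: "q \<in> poly_ideal p 0 \<Longrightarrow> poly_cong p q q"
  by (simp add: poly_cong_def poly_ideal_zero)

lemma poly_cong_add: "poly_cong p q r \<Longrightarrow> poly_cong p q' r' \<Longrightarrow> poly_cong p (q + q') (r + r')"
  using poly_ideal_add[of "q - r" 1 "q' - r'"] by (auto simp: poly_cong_def poly_ideal_add algebra_simps)

lemma poly_cong_mult:
  assumes "poly_cong p q r" "poly_cong p q' r'"
  shows "poly_cong p (q * q') (r * r')"
proof -
  have "(q - r) * q' + r * (q' - r') \<in> poly_ideal p 1"
    using assms poly_ideal_mult[of _ 1 _ 0] poly_ideal_mult[of _ 0 _ 1]
    by (intro poly_ideal_add) (auto simp: poly_cong_def)
  thus ?thesis
    using assms poly_ideal_mult[of _ 0 _ 0] by (auto simp: poly_cong_def algebra_simps)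
qed

lemma poly_cong_sum: "(\<And>i. i \<in> S \<Longrightarrow> poly_cong p (f i) (g i)) \<Longrightarrow> poly_cong p (sum f S) (sum g S)"
  by (induction S rule: infinite_finite_induct)
     (auto intro: poly_cong_add poly_cong_refl poly_ideal_zero)

lemma poly_ideal_of_nat: "of_nat n \<in> poly_ideal p 0"
  by (simp add: of_nat_poly poly_ideal_pCons_iff padic_ideal_0_iff padic_int_of_nat poly_ideal_zero)

lemma poly_cong_pochhammer: "poly_cong p q r \<Longrightarrow> poly_cong p (pochhammer q n) (pochhammer r n)"
proof (induction n)
  case 0
  thus ?case using poly_ideal_of_nat[of 1] by (simp add: poly_cong_refl)
next
  case (Suc n)
  thus ?case
    by (simp add: pochhammer_Suc poly_cong_mult poly_cong_add poly_cong_refl poly_ideal_of_nat)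
qed

lemma poly_cong_const_iff:
  "poly_cong p [:a:] [:b:] \<longleftrightarrow> a \<in> padic_ideal p 0 \<and> b \<in> padic_ideal p 0 \<and> a - b \<in> padic_ideal p 1"
  by (simp add: poly_cong_def poly_ideal_pCons_iff poly_ideal_zero)

lemma poly_in_padic_ideal:
  assumes "q \<in> poly_ideal p n" "x \<in> padic_ideal p 0"
  shows "poly q x \<in> padic_ideal p n"
  using assms(1)
proof (induction q)
  case (pCons c q)
  thus ?case
    using padic_ideal_mult[OF assms(2), of "poly q x" n]
    by (auto simp: poly_ideal_pCons_iff padic_ideal_add)
qed (simp add: padic_ideal_zero)

lemma padic_ideal_Suc_subset: "padic_ideal p (Suc n) \<subseteq> padic_ideal p n"
proof
  fix x assume "x \<in> padic_ideal p (Suc n)"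
  then obtain z where z: "z \<in> rat_padic_integers p" "x = of_nat p ^ Suc n * z"
    by (auto simp: padic_ideal_def)
  show "x \<in> padic_ideal p n"
    unfolding padic_ideal_def
    using z padic_int_mult[OF padic_int_of_nat[of p] z(1)] by (intro image_eqI[of _ _ "of_nat p * z"]) auto
qed

text \<open>With P = c0 + c1 x + x^2 R, adding the two zeros gives 2 c0 = -h^2 (R(h) + R(-h)). Two
  factors p come from h^2, the third from the coefficients of R; oddness of p allows division by
  2.\<close>

lemma poly_0_in_padic_ideal_3:
  assumes "odd p" and P: "P \<in> poly_ideal p 1" and h: "h \<in> padic_ideal p 1"
    and "poly P h = 0" "poly P (- h) = 0"
  shows "poly P 0 \<in> padic_ideal p 3"
proof -
  obtain c0 c1 R where PR: "P = pCons c0 (pCons c1 R)"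
    by (metis pCons_cases)
  have R: "R \<in> poly_ideal p 1"
    using P by (simp add: PR poly_ideal_pCons_iff)
  have "\<not> p dvd 2"
    using \<open>odd p\<close> p primes_dvd_imp_eq[of p 2] by auto
  hence half: "- 1 / 2 \<in> padic_ideal p 0"
    using padic_int_mult[OF padic_int_of_int[of "-1"] padic_int_inverse_of_nat[of 2]]
    by (simp add: padic_ideal_0_iff)
  have h0: "h \<in> padic_ideal p 0" "- h \<in> padic_ideal p 0"
    using h padic_ideal_Suc_subset[of 0] padic_ideal_mult[of "-1" 0 h 0] padic_int_of_int[of "-1"]
    by (auto simp: padic_ideal_0_iff)
  have "poly R h + poly R (- h) \<in> padic_ideal p 1"
    using R h0 by (intro padic_ideal_add poly_in_padic_ideal)
  hence "(- 1 / 2) * ((h * h) * (poly R h + poly R (- h))) \<in> padic_ideal p (0 + ((1 + 1) + 1))"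
    using h half by (intro padic_ideal_mult)
  moreover have "poly P 0 = (- 1 / 2) * ((h * h) * (poly R h + poly R (- h)))"
    using assms(4,5) by (simp add: PR field_simps)
  ultimately show ?thesis by (simp add: numeral_3_eq_3)
qed

end

section \<open>The zeros at plus and minus p/3\<close>

lemma not_Int_third:
  "of_int l + 1 / 3 \<notin> (\<int> :: rat set)" "of_int l - 1 / 3 \<notin> (\<int> :: rat set)"
proof -
  show "of_int l + 1 / 3 \<notin> (\<int> :: rat set)"
  proof
    assume "of_int l + 1 / 3 \<in> (\<int> :: rat set)"
    then obtain k where "of_int l + 1 / 3 = (of_int k :: rat)" by (elim Ints_cases)
    hence "of_int (3 * l + 1) = (of_int (3 * k) :: rat)" by simp
    hence "3 * l + 1 = 3 * k" by (simp only: of_int_eq_iff)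
    thus False by presburger
  qed
  show "of_int l - 1 / 3 \<notin> (\<int> :: rat set)"
  proof
    assume "of_int l - 1 / 3 \<in> (\<int> :: rat set)"
    then obtain k where "of_int l - 1 / 3 = (of_int k :: rat)" by (elim Ints_cases)
    hence "of_int (3 * l - 1) = (of_int (3 * k) :: rat)" by simp
    hence "3 * l - 1 = 3 * k" by (simp only: of_int_eq_iff)
    thus False by presburger
  qed
qed

text \<open>This undoes the clearing of denominators: for non-integral x the Pochhammer symbols
  divided by are nonzero, and the prefactor does not depend on j.\<close>

lemma wp_term_eq_quotient:
  fixes a x :: "'a :: field_char_0" and s :: nat
  assumes "j \<le> M" "x \<notin> \<int>"
  defines "A \<equiv> a + 2 * of_nat s"
  shows "wp_term a M s x j =
    pochhammer a (2 * s) * fact M * pochhammer (1 + 2 * of_nat s - x) M * pochhammer (1 + of_nat s + x) M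
    * ((A + 2 * of_nat j) * pochhammer A j * pochhammer (a + x) j * pochhammer (a + of_nat s - x) j
        / (fact j * pochhammer (1 + 2 * of_nat s - x) j * pochhammer (1 + of_nat s + x) j))"
proof -
  have x: "1 + 2 * of_nat s - x \<notin> \<int>" "1 + of_nat s + x \<notin> \<int>"
    using assms(2) by auto
  have 1: "pochhammer a (j + 2 * s) = pochhammer a (2 * s) * pochhammer A j"
    unfolding A_def by (metis add.commute of_nat_mult of_nat_numeral pochhammer_product')
  have 2: "pochhammer (y + of_nat j) (M - j) = pochhammer y M / pochhammer y j" if "y \<notin> \<int>" for y :: 'a
    using pochhammer_neq_0_if_not_Int[OF that, of j] pochhammer_product[OF assms(1), of y] by simp
  have 3: "1 + 2 * of_nat s + of_nat j - x = 1 + 2 * of_nat s - x + of_nat j"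
    "1 + of_nat s + of_nat j + x = 1 + of_nat s + x + of_nat j"
    by simp_all
  show ?thesis
    unfolding wp_term_def 1 3 2[OF x(1)] 2[OF x(2)] by (simp add: A_def mult_ac)
qed

lemma sum_wp_term_eq_0:
  fixes M s :: nat and x :: rat
  assumes "s < M" and x: "x = of_nat M - 1 / 3 \<or> x = - (of_nat M - 1 / 3)"
  shows "(\<Sum>j\<le>M. wp_term (- 1 / 3) M s x j) = 0"
proof -
  define A d :: rat where "A = - 1 / 3 + 2 * of_nat s" and "d = of_nat s + 1 / 3"
  have "A \<notin> \<int>" "d \<notin> \<int>"
    using not_Int_third(2)[of "2 * int s"] not_Int_third(1)[of "int s"] by (simp_all add: A_def d_def)
  have d: "d = (1 + A) / 2" by (simp add: A_def d_def field_simps)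
  have "x \<notin> \<int>"
    using x not_Int_third(2)[of "int M"] not_Int_third(1)[of "- int M"] by auto
  define t where "t j = (A + 2 * of_nat j) * pochhammer A j * pochhammer (- 1 / 3 + x) j
    * pochhammer (- 1 / 3 + of_nat s - x) j
    / (fact j * pochhammer (1 + 2 * of_nat s - x) j * pochhammer (1 + of_nat s + x) j)" for j
  have "(\<Sum>j\<le>M. t j) = 0"
    using x
  proof
    assume x: "x = of_nat M - 1 / 3"
    \<comment> \<open>Here the parameter a + s - x is the one that becomes a nonpositive integer,
      -(M - s), so the series stops at M - s; \<open>s < M\<close> ensures
      \<open>m \<ge> 1\<close>.\<close>
    define m where "m = M - s"
    have m: "m \<ge> 1" "m \<le> M" using \<open>s < M\<close> by (auto simp: m_def)
    have eqs: "- 1 / 3 + of_nat s - x = - of_nat m" "1 + of_nat s + x = 1 + A + of_nat m"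
      "- 1 / 3 + x = d + of_nat (m - 1)" "1 + 2 * of_nat s - x = d - of_nat (m - 1)"
      using \<open>s < M\<close> by (simp_all add: x m_def A_def d_def of_nat_diff)
    have "(\<Sum>j\<le>M. t j) = (\<Sum>j\<le>m. t j)"
      unfolding t_def eqs using m(2) by (intro sum.mono_neutral_right) (auto simp: pochhammer_of_nat_eq_0_lemma)
    also have "\<dots> = 0"
      using very_well_poised_sum_eq_0[OF \<open>A \<notin> \<int>\<close> \<open>d \<notin> \<int>\<close> m(1) d] unfolding t_def eqs by (simp add: mult_ac)
    finally show ?thesis .
  next
    assume x: "x = - (of_nat M - 1 / 3)"
    have m: "M \<ge> 1" using \<open>s < M\<close> by auto
    \<comment> \<open>Now a + x terminates the series, at M itself, and the two pairs of parameters
      exchange their roles.\<close>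
    have eqs: "- 1 / 3 + x = - of_nat M" "1 + 2 * of_nat s - x = 1 + A + of_nat M"
      "- 1 / 3 + of_nat s - x = d + of_nat (M - 1)" "1 + of_nat s + x = d - of_nat (M - 1)"
      using m by (simp_all add: x A_def d_def of_nat_diff)
    show ?thesis
      using very_well_poised_sum_eq_0[OF \<open>A \<notin> \<int>\<close> \<open>d \<notin> \<int>\<close> m d] unfolding t_def eqs by (simp add: mult_ac)
  qed
  moreover have "wp_term (- 1 / 3) M s x j = pochhammer (- 1 / 3) (2 * s) * fact M
      * pochhammer (1 + 2 * of_nat s - x) M * pochhammer (1 + of_nat s + x) M * t j" if "j \<le> M" for j
    using wp_term_eq_quotient[OF that \<open>x \<notin> \<int>\<close>] by (simp only: t_def A_def)
  ultimately show ?thesis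
    by (simp flip: sum_distrib_left)
qed

section \<open>The polynomial in x and its reduction modulo p\<close>

text \<open>The variable x of \<open>wp_term\<close> becomes the indeterminate, so that
  coefficients, not just values, can be compared modulo p. Constants are written as constant
  polynomials to let one congruence rule for \<open>pochhammer\<close> cover every factor.\<close>

definition wp_poly :: "'a :: field_char_0 \<Rightarrow> nat \<Rightarrow> nat \<Rightarrow> nat \<Rightarrow> 'a poly" where
  "wp_poly a M s j =
     [:a + 2 * of_nat s + 2 * of_nat j:] * pochhammer [:a:] (j + 2 * s) * [:fact M / fact j:]
       * (pochhammer [:a, 1:] j * pochhammer [:1 + 2 * of_nat s + of_nat j, - 1:] (M - j)
          * (pochhammer [:a + of_nat s, - 1:] j * pochhammer [:1 + of_nat s + of_nat j, 1:] (M - j)))"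

lemma poly_pochhammer: "poly (pochhammer q n) x = pochhammer (poly q x) n"
  for q :: "'a :: comm_semiring_1 poly"
  by (induction n) (simp_all add: pochhammer_Suc)

lemma poly_wp_poly: "poly (wp_poly a M s j) x = wp_term a M s x j"
  by (simp add: wp_poly_def wp_term_def poly_pochhammer algebra_simps)

lemma poly_cong_wp_poly:
  assumes p: "prime p" and ab: "a \<in> padic_ideal p 0" "b \<in> padic_ideal p 0" "a - b \<in> padic_ideal p 1"
    and "j \<le> M"
  shows "poly_cong p (wp_poly a M s j) (wp_poly b M s j)"
proof -
  have int: "of_int k \<in> padic_ideal p 0" for k
    using padic_int_of_int[OF p] by (simp add: padic_ideal_0_iff[OF p])
  have const: "poly_cong p [:c:] [:c:]" if "c \<in> padic_ideal p 0" for c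
    using that padic_ideal_zero[OF p] by (simp add: poly_cong_const_iff[OF p])
  have lin: "poly_cong p [:c, of_int k:] [:c', of_int k:]"
    if "poly_cong p [:c:] [:c':]" for c c' k
    using that int padic_ideal_zero[OF p]
    by (simp add: poly_cong_def poly_ideal_pCons_iff[OF p] poly_ideal_zero[OF p])
  have shift: "poly_cong p [:a + of_int k:] [:b + of_int k:]" for k
    using ab int[of k] by (simp add: poly_cong_const_iff[OF p] padic_ideal_add[OF p])
  \<comment> \<open>The only quotient in \<open>wp_poly\<close> is an integer because
    \<open>j \<le> M\<close>.\<close>
  obtain k :: int where "fact M = fact j * k"
    using fact_dvd[OF \<open>j \<le> M\<close>] by (elim dvdE)
  hence "fact M = fact j * (of_int k :: rat)"
    by (metis of_int_fact of_int_mult)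
  hence "poly_cong p [:fact M / fact j:] [:fact M / fact j:]"
    using const[OF int[of k]] by simp
  thus ?thesis
    unfolding wp_poly_def
    using shift[of "2 * int s + 2 * int j"] shift[of 0] lin[OF shift[of 0], of 1] lin[OF shift[of "int s"], of "-1"]
      lin[OF const[OF int[of "1 + 2 * int s + int j"]], of "-1"]
      lin[OF const[OF int[of "1 + int s + int j"]], of 1]
    by (intro poly_cong_mult[OF p] poly_cong_pochhammer[OF p]) (simp_all add: add_ac)
qed

text \<open>With k = j + s, the factor 6k - 1 is 3(a + 2s + 2j). Splitting the symbol of length j +
  s at s yields the parameter a + s, and the factorials are completed to ones independent of
  j.\<close>

lemma summand_eq_wp_term:
  assumes "j \<le> M"
  shows "(6 * of_nat (j + s) - 1)
      * (pochhammer (- 1 / 3) j * pochhammer (- 1 / 3) (j + s + s) * pochhammer (- 1 / 3) (j + s))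
      / (fact j * fact (j + s + s) * fact (j + s))
    = 3 * pochhammer (- 1 / 3) s / (fact M * fact (2 * s + M) * fact (s + M)) * wp_term (- 1 / 3) M s 0 j"
    (is "?l = _ * wp_term ?a M s 0 j")
proof -
  have 1: "pochhammer ?a (j + s) = pochhammer ?a s * pochhammer (?a + of_nat s) j"
    by (metis add.commute pochhammer_product')
  have 2: "pochhammer (1 + of_nat k) (M - j) = (fact (i + M) / fact k :: 'a)" if "k = i + j" for k i
    using pochhammer_product'[of "1 :: 'a" k "M - j"] assms that by (simp flip: pochhammer_fact)
  have 3: "pochhammer (1 + 2 * of_nat s + of_nat j) (M - j) = (fact (2 * s + M) / fact (j + s + s) :: 'a)"
    "pochhammer (1 + of_nat s + of_nat j) (M - j) = (fact (s + M) / fact (j + s) :: 'a)"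
    using 2[of "j + s + s" "2 * s"] 2[of "j + s" s] by (simp_all add: add_ac)
  have 4: "j + s + s = j + 2 * s" by simp
  define c where "c = ?a + 2 * of_nat s + 2 * of_nat j"
  have 5: "6 * of_nat (j + s) - 1 = 3 * c" by (simp add: c_def)
  show ?thesis
    unfolding wp_term_def c_def[symmetric] 5 1 4 using 3 by (simp add: 4 mult_ac)
qed

section \<open>Assembly of the congruence modulo p^3\<close>

theorem corollary1p2:
  fixes p s :: nat
  assumes "prime p"
    and "[p = 2] (mod 3)"
    and "real s \<le> (real p - 2) / 3"
  shows "padic_cong p 3
    (\<Sum>k = s..(p + 1) div 3 + s.
       (6 * of_nat k - 1) *
       (pochhammer (- 1 / 3) (k - s) * pochhammer (- 1 / 3) (k + s) * pochhammer (- 1 / 3) k)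
       / (fact (k - s) * fact (k + s) * fact k))
    0"
proof -
  note p = assms(1)
  define M where "M = (p + 1) div 3"
  have M: "p + 1 = 3 * M"
    using assms(2) unfolding M_def cong_def by presburger
  have sp: "3 * s + 2 \<le> p"
  proof -
    have "real (3 * s + 2) \<le> real p" using assms(3) by simp
    thus ?thesis by (simp only: of_nat_le_iff)
  qed
  have "s < M" using M sp by linarith
  have "\<not> p dvd 3"
  proof
    assume "p dvd 3"
    hence "p dvd p + 1" unfolding M by (rule dvd_mult2)
    with p show False using dvd_add_right_iff[of p p 1] by simp
  qed
  define S where "S = (\<Sum>k = s..M + s.
       (6 * of_nat k - 1) *
       (pochhammer (- 1 / 3) (k - s) * pochhammer (- 1 / 3) (k + s) * pochhammer (- 1 / 3) k)
       / (fact (k - s) * fact (k + s) * fact k) :: rat)"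
  have third: "1 / 3 \<in> rat_padic_integers p" "- 1 / 3 \<in> rat_padic_integers p"
    using padic_int_inverse_of_nat[OF p \<open>\<not> p dvd 3\<close>] padic_int_mult[OF p padic_int_of_int[OF p, of "-1"], of "1 / 3"]
    by auto
  have "S \<in> padic_ideal p 3"
  proof (cases "even p")
    \<comment> \<open>For p = 2 neither the reflection (M = 1 is odd) nor division by 2 is
      available. The two terms are -1 and -5/27, with sum -32/27 = 2^3 * (-4/27).\<close>
    case True
    hence "p = 2" using p primes_dvd_imp_eq[of 2 p] by auto
    hence "s = 0" "M = 1" using sp M by auto
    hence "S = of_nat p ^ 3 * (of_int (-4) * ((1 / 3) * ((1 / 3) * (1 / 3))))"
      using \<open>p = 2\<close> by (simp add: S_def)
    thus ?thesis
      unfolding padic_ideal_def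
      using third padic_int_of_int[OF p] by (blast intro: padic_int_mult[OF p])
  next
    case False
    hence "even M" using M by presburger
    define P where "P = (\<Sum>j\<le>M. wp_poly (- 1 / 3 :: rat) M s j)"
    define C :: rat where "C = 3 * pochhammer (- 1 / 3) s / (fact M * fact (2 * s + M) * fact (s + M))"
    define h :: rat where "h = of_nat M - 1 / 3"
    have h: "h = of_nat p * (1 / 3)"
      using arg_cong[OF M, of "of_nat :: nat \<Rightarrow> rat"] by (simp add: h_def field_simps)
    have "h \<in> padic_ideal p 1"
      unfolding padic_ideal_def using third(1) h by (intro image_eqI[of _ _ "1 / 3"]) simp_all
    have "S = (\<Sum>j = 0..M. C * wp_term (- 1 / 3) M s 0 j)"
      unfolding S_def C_def sum.shift_bounds_cl_nat_ivl[of _ 0 s M, unfolded add_0_left] add_diff_cancel_right'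
      by (intro sum.cong refl summand_eq_wp_term) simp
    hence S: "S = C * poly P 0"
      by (simp add: P_def poly_sum poly_wp_poly sum_distrib_left atMost_atLeast0)
    \<comment> \<open>The parameters -1/3 and -M differ by exactly \<open>h\<close> = p/3, hence are
      congruent modulo p.\<close>
    have "poly_cong p P (\<Sum>j\<le>M. wp_poly (- of_nat M) M s j)"
      unfolding P_def using third \<open>h \<in> padic_ideal p 1\<close> padic_int_of_int[OF p, of "- int M"]
      by (intro poly_cong_sum[OF p] poly_cong_wp_poly[OF p]) (auto simp: padic_ideal_0_iff[OF p] h_def)
    \<comment> \<open>A rational polynomial vanishing at every point is the zero polynomial.\<close>
    also have "(\<Sum>j\<le>M. wp_poly (- of_nat M :: rat) M s j) = 0"
      using sum_wp_term_reflection_eq_0[OF \<open>even M\<close>, where 'a = rat]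
      by (subst poly_all_0_iff_0[symmetric]) (simp add: poly_sum poly_wp_poly)
    finally have "P \<in> poly_ideal p 1"
      by (simp add: poly_cong_def)
    moreover have "poly P h = 0" "poly P (- h) = 0"
      using sum_wp_term_eq_0[OF \<open>s < M\<close>] by (simp_all add: P_def poly_sum poly_wp_poly h_def)
    ultimately have "poly P 0 \<in> padic_ideal p 3"
      using False \<open>h \<in> padic_ideal p 1\<close> poly_0_in_padic_ideal_3[OF p] by blast
    moreover have "C \<in> padic_ideal p 0"
    proof -
      have fact: "1 / fact n \<in> rat_padic_integers p" if "n < p" for n
        using padic_int_inverse_of_nat[OF p, of "fact n"] that by (simp add: prime_dvd_fact_iff[OF p])
      have "pochhammer (- 1 / 3) s \<in> rat_padic_integers p"
        using third(2) by (rule padic_int_pochhammer[OF p])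
      \<comment> \<open>From s \<le> (p - 2)/3 and M = (p + 1)/3 it follows that 2s + M \<le> p - 1,
        so no factorial in the denominator of \<open>C\<close> is divisible by p.\<close>
      moreover have "M < p" "2 * s + M < p" "s + M < p"
        using M sp by linarith+
      ultimately have "of_nat 3 * (pochhammer (- 1 / 3) s * (1 / fact M * (1 / fact (2 * s + M) * (1 / fact (s + M)))))
          \<in> rat_padic_integers p"
        by (intro padic_int_mult[OF p] padic_int_of_nat[OF p] fact)
      thus ?thesis
        by (simp add: C_def padic_ideal_0_iff[OF p] mult.assoc)
    qed
    ultimately show ?thesis
      using padic_ideal_mult[OF p, of C 0 "poly P 0" 3] by (simp add: S)
  qed
  moreover have "S \<in> rat_padic_integers p"
    using calculation padic_ideal_Suc_subset[OF p] padic_ideal_0_iff[OF p]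
    by (metis numeral_3_eq_3 subsetD)
  ultimately show ?thesis
    using padic_int_of_int[OF p, of 0]
    by (simp add: padic_cong_def S_def M_def padic_ideal_def)
qed

end
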